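(* Let $\underline d=(d_1,\dots,d_r)$ be a shape, let $l_d=\sum_{j=1}^r d_j$, and let $\underline{l_d}=(1,\dots,1)$ ($l_d$ entries). Then the map $$\Gamma(\underline d)\longrightarrow\Gamma(\underline{l_d}),\qquad \gamma\longmapsto\gamma_{w(\gamma)}$$ is a crystal morphism.
   Context: Fix a positive integer $n$. **Weights.** $X=\bigoplus_{i=1}^n\mathbb Z\varepsilon_i/\langle\sum_i\varepsilon_i\rangle$ is the weight lattice of $\mathrm{SL}_n(\mathbb C)$, with simple roots $\alpha_i=\varepsilon_i-\varepsilon_{i+1}$, $1\le i\le n-1$. **Galleries.** A shape is a finite sequence $\underline d=(d_1,\dots,d_r)$ of integers with $1\le d_s\le n-1$. A gallery of shape $\underline d$ is a sequence of columns $(c_1,\dots,c_r)$, numbered from right to left (column 1 is rightmost), where $c_s$ is a column of $d_s$ boxes filled with elements of $\{1,\dots,n\}$ strictly increasing from top to bottom. $\Gamma(\underline d)$ is the set of galleries of shape $\underline d$. The weight is $\operatorname{wt}(\gamma)=\sum_i\lambda_i\varepsilon_i\in X$, where $\lambda_i$ is the number of entries of $\gamma$ equal to $i$. **Words.** The word $w(\gamma)$ of a gallery is obtained by reading the columns $c_1,c_2,\dots,c_r$ in this order (right to left), each from top to bottom, and writing the letters from left to right. For a word $w=a_1\cdots a_k$ in $\{1,\dots,n\}$, $\gamma_w$ is the gallery of shape $(1,\dots,1)$ whose $s$-th column (from the right) is the single box $a_s$. **Crystals.** A crystal is a set $B$ with maps $\operatorname{wt}:B\to X$ and $e_{\alpha_i},f_{\alpha_i}:B\to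 B\cup\{0\}$ ($1\le i\le n-1$) such that $b'=e_{\alpha_i}(b)$ iff $b=f_{\alpha_i}(b')$ for $b,b'\in B$, in this case $\operatorname{wt}(b')=\operatorname{wt}(b)+\alpha_i$, and $\phi_{\alpha_i}(b)=\epsilon_{\alpha_i}(b)+(\operatorname{wt}(b),\alpha_i^\vee)$, where $\epsilon_{\alpha_i}(b)=\max\{m:e_{\alpha_i}^m(b)\ne0\}$, $\phi_{\alpha_i}(b)=\max\{m:f_{\alpha_i}^m(b)\neq0\}$. A crystal morphism is a map of underlying sets preserving $\operatorname{wt}$ and commuting with all root operators $e_{\alpha_i},f_{\alpha_i}$ (with $0\mapsto0$). **Crystal structure on galleries.** Given $i$, tag each column of $\gamma$ by $+$ if it contains $i$ but not $i+1$, by $-$ if it contains $i+1$ but not $i$, and by $\emptyset$ otherwise. Read the tags from left to right (i.e. columns $r,r-1,\dots,1$), ignore $\emptyset$, and recursively delete adjacent pairs $(-\,+)$ until the remaining tags have the form $(+)^s(-)^r$. Then $f_{\alpha_i}$ replaces $i$ by $i+1$ in the column of the rightmost remaining $+$ (and $f_{\alpha_i}(\gamma)=0$ if there is none); $e_{\alpha_i}$ replaces $i+1$ by $i$ in the column of the leftmost remaining $-$ (and $e_{\alpha_i}(\gamma)=0$ if there is none). These operators preserve shape and make each $\Gamma(\underline d)$ a crystal. *)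

theory Defs
  imports "HOL-Algebra.Free_Abelian_Groups"
begin

section \<open>The weight lattice\<close>

text \<open>The relation subgroup generated by the sum of all epsilon's, where epsilon i is the
  generator \<^term>\<open>frag_of i\<close>. Weights are its cosets.\<close>

definition eps_relation :: "nat \<Rightarrow> (nat \<Rightarrow>\<^sub>0 int) set" where
  "eps_relation n = generate (free_Abelian_group {1..n}) {\<Sum>i\<in>{1..n}. frag_of i}"

definition weight_lattice :: "nat \<Rightarrow> (nat \<Rightarrow>\<^sub>0 int) set monoid" where
  "weight_lattice n = free_Abelian_group {1..n} Mod eps_relation n"

definition weight_class :: "nat \<Rightarrow> (nat \<Rightarrow>\<^sub>0 int) \<Rightarrow> (nat \<Rightarrow>\<^sub>0 int) set" where
  "weight_class n v = eps_relation n #>\<^bsub>free_Abelian_group {1..n}\<^esub> v"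

definition simple_root :: "nat \<Rightarrow> nat \<Rightarrow> (nat \<Rightarrow>\<^sub>0 int) set" where
  "simple_root n i = weight_class n (frag_of i - frag_of (i + 1))"

text \<open>The pairing of a weight with the i-th simple coroot. The difference of coordinates
  does not depend on the representative, so the image below is a singleton.\<close>

definition coroot_pairing :: "(nat \<Rightarrow>\<^sub>0 int) set \<Rightarrow> nat \<Rightarrow> int" where
  "coroot_pairing x i =
     the_elem ((\<lambda>v. Poly_Mapping.lookup v i - Poly_Mapping.lookup v (i + 1)) ` x)"

lemma coroot_pairing_weight_class:
  "i \<in> {1..<n} \<Longrightarrow> coroot_pairing (weight_class n v) i =
     Poly_Mapping.lookup v i - Poly_Mapping.lookup v (i + 1)"
proof -
  assume i: "i \<in> {1..<n}"
  let ?G = "free_Abelian_group {1..n}" let ?s = "\<Sum>i\<in>{1..n}. frag_of i :: nat \<Rightarrow>\<^sub>0 int"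
  have G: "group ?G" by simp
  have s: "?s \<in> carrier ?G" by (auto simp: free_Abelian_group_def intro!: Poly_Mapping.keys_sum[THEN subset_trans])
  have l: "Poly_Mapping.lookup ?s j = 1" if "j \<in> {1..n}" for j using that by (simp add: lookup_sum sum.delta)
  have z: "Poly_Mapping.lookup u i = Poly_Mapping.lookup u (i+1)" if "u \<in> eps_relation n" for u
    using that unfolding eps_relation_def
  proof (induction rule: generate.induct)
    case (inv h) then show ?case using s l i by (simp add: inv_free_Abelian_group)
  qed (use l i in \<open>auto simp: lookup_add\<close>)
  have o: "0 \<in> eps_relation n" unfolding eps_relation_def using generate.one[of ?G] by simp
  have "(\<lambda>v. Poly_Mapping.lookup v i - Poly_Mapping.lookup v (i + 1)) ` weight_class n v = {Poly_Mapping.lookup v i - Poly_Mapping.lookup v (i + 1)}"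
    unfolding weight_class_def r_coset_def using o z by (fastforce simp: lookup_add)
  then show ?thesis by (simp add: coroot_pairing_def)
qed

section \<open>Crystals\<close>

text \<open>The extra element 0 in the codomain of the root operators is \<^term>\<open>None\<close>.\<close>

record 'b crystal_data =
  elems :: "'b set"
  wt :: "'b \<Rightarrow> (nat \<Rightarrow>\<^sub>0 int) set"
  e_op :: "nat \<Rightarrow> 'b \<Rightarrow> 'b option"
  f_op :: "nat \<Rightarrow> 'b \<Rightarrow> 'b option"

definition iterate_op :: "('b \<Rightarrow> 'b option) \<Rightarrow> nat \<Rightarrow> 'b \<Rightarrow> 'b option" where
  "iterate_op g m b = ((\<lambda>x. Option.bind x g) ^^ m) (Some b)"

definition eps_len :: "'b crystal_data \<Rightarrow> nat \<Rightarrow> 'b \<Rightarrow> nat" where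
  "eps_len B i b = Max {m. iterate_op (e_op B i) m b \<noteq> None}"

definition phi_len :: "'b crystal_data \<Rightarrow> nat \<Rightarrow> 'b \<Rightarrow> nat" where
  "phi_len B i b = Max {m. iterate_op (f_op B i) m b \<noteq> None}"

text \<open>The two finiteness axioms say that the maxima defining \<^const>\<open>eps_len\<close> and
  \<^const>\<open>phi_len\<close> exist.\<close>

locale crystal =
  fixes n :: nat and B :: "'b crystal_data"
  assumes wt_closed: "b \<in> elems B \<Longrightarrow> wt B b \<in> carrier (weight_lattice n)"
    and e_closed: "\<lbrakk>i \<in> {1..<n}; b \<in> elems B; e_op B i b = Some b'\<rbrakk> \<Longrightarrow> b' \<in> elems B"
    and f_closed: "\<lbrakk>i \<in> {1..<n}; b \<in> elems B; f_op B i b = Some b'\<rbrakk> \<Longrightarrow> b' \<in> elems B"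
    and e_f_inverse: "\<lbrakk>i \<in> {1..<n}; b \<in> elems B; b' \<in> elems B\<rbrakk>
      \<Longrightarrow> e_op B i b = Some b' \<longleftrightarrow> f_op B i b' = Some b"
    and wt_e: "\<lbrakk>i \<in> {1..<n}; b \<in> elems B; e_op B i b = Some b'\<rbrakk>
      \<Longrightarrow> wt B b' = wt B b \<otimes>\<^bsub>weight_lattice n\<^esub> simple_root n i"
    and e_finite: "\<lbrakk>i \<in> {1..<n}; b \<in> elems B\<rbrakk>
      \<Longrightarrow> finite {m. iterate_op (e_op B i) m b \<noteq> None}"
    and f_finite: "\<lbrakk>i \<in> {1..<n}; b \<in> elems B\<rbrakk>
      \<Longrightarrow> finite {m. iterate_op (f_op B i) m b \<noteq> None}"
    and phi_eps: "\<lbrakk>i \<in> {1..<n}; b \<in> elems B\<rbrakk>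
      \<Longrightarrow> int (phi_len B i b) = int (eps_len B i b) + coroot_pairing (wt B b) i"

locale crystal_morphism = source: crystal n A + target: crystal n B
  for n :: nat and A :: "'a crystal_data" and B :: "'b crystal_data" +
  fixes \<psi> :: "'a \<Rightarrow> 'b"
  assumes map_closed: "\<psi> \<in> elems A \<rightarrow> elems B"
    and map_wt: "a \<in> elems A \<Longrightarrow> wt B (\<psi> a) = wt A a"
    and map_e: "\<lbrakk>i \<in> {1..<n}; a \<in> elems A\<rbrakk> \<Longrightarrow> e_op B i (\<psi> a) = map_option \<psi> (e_op A i a)"
    and map_f: "\<lbrakk>i \<in> {1..<n}; a \<in> elems A\<rbrakk> \<Longrightarrow> f_op B i (\<psi> a) = map_option \<psi> (f_op A i a)"

section \<open>Galleries\<close>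

text \<open>A column is listed from top to bottom. A gallery is the list of its columns in the order
  of their numbering, so the head of the list is the rightmost column.\<close>

type_synonym column = "nat list"
type_synonym gallery = "column list"

definition is_shape :: "nat \<Rightarrow> nat list \<Rightarrow> bool" where
  "is_shape n d \<longleftrightarrow> (\<forall>k\<in>set d. 1 \<le> k \<and> k \<le> n - 1)"

definition galleries :: "nat \<Rightarrow> nat list \<Rightarrow> gallery set" where
  "galleries n d =
     {\<gamma>. map length \<gamma> = d \<and> (\<forall>c\<in>set \<gamma>. sorted_wrt (<) c \<and> set c \<subseteq> {1..n})}"

definition word :: "gallery \<Rightarrow> nat list" where
  "word \<gamma> = concat \<gamma>"

definition gallery_of_word :: "nat list \<Rightarrow> gallery" where
  "gallery_of_word w = map (\<lambda>a. [a]) w"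

definition gallery_wt :: "nat \<Rightarrow> gallery \<Rightarrow> (nat \<Rightarrow>\<^sub>0 int) set" where
  "gallery_wt n \<gamma> = weight_class n
     (\<Sum>i\<in>{1..n}. Poly_Mapping.single i (\<Sum>c\<leftarrow>\<gamma>. int (count_list c i)))"

section \<open>The signature rule\<close>

datatype sign = Plus | Minus

definition tag :: "nat \<Rightarrow> column \<Rightarrow> sign option" where
  "tag i c =
     (if i \<in> set c \<and> i + 1 \<notin> set c then Some Plus
      else if i + 1 \<in> set c \<and> i \<notin> set c then Some Minus
      else None)"

text \<open>The nonempty tags as they appear from left to right in the drawn gallery, that is, in
  decreasing order of column number. Each tag is paired with the list index of its column.\<close>

definition signature :: "nat \<Rightarrow> gallery \<Rightarrow> (nat \<times> sign) list" where
  "signature i \<gamma> =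
     [(s, the (tag i (\<gamma> ! s))). s \<leftarrow> rev [0..<length \<gamma>], tag i (\<gamma> ! s) \<noteq> None]"

inductive cancels :: "(nat \<times> sign) list \<Rightarrow> (nat \<times> sign) list \<Rightarrow> bool" where
  "cancels (xs @ (p, Minus) # (q, Plus) # ys) (xs @ ys)"

definition sign_normal :: "(nat \<times> sign) list \<Rightarrow> bool" where
  "sign_normal ts \<longleftrightarrow> (\<exists>k l. map snd ts = replicate k Plus @ replicate l Minus)"

definition reduced_signature :: "nat \<Rightarrow> gallery \<Rightarrow> (nat \<times> sign) list" where
  "reduced_signature i \<gamma> = (THE ts. cancels\<^sup>*\<^sup>* (signature i \<gamma>) ts \<and> sign_normal ts)"

definition replace_entry :: "nat \<Rightarrow> nat \<Rightarrow> column \<Rightarrow> column" where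
  "replace_entry a b c = map (\<lambda>x. if x = a then b else x) c"

definition gallery_f :: "nat \<Rightarrow> gallery \<Rightarrow> gallery option" where
  "gallery_f i \<gamma> =
     (let ps = [s. (s, t) \<leftarrow> reduced_signature i \<gamma>, t = Plus] in
      if ps = [] then None
      else Some (\<gamma>[last ps := replace_entry i (i + 1) (\<gamma> ! last ps)]))"

definition gallery_e :: "nat \<Rightarrow> gallery \<Rightarrow> gallery option" where
  "gallery_e i \<gamma> =
     (let ps = [s. (s, t) \<leftarrow> reduced_signature i \<gamma>, t = Minus] in
      if ps = [] then None
      else Some (\<gamma>[hd ps := replace_entry (i + 1) i (\<gamma> ! hd ps)]))"

definition gallery_crystal :: "nat \<Rightarrow> nat list \<Rightarrow> gallery crystal_data" where
  "gallery_crystal n d =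
     \<lparr>elems = galleries n d, wt = gallery_wt n, e_op = gallery_e, f_op = gallery_f\<rparr>"

section \<open>The reduced signature is well defined\<close>

fun reduce_signs :: "(nat \<times> sign) list \<Rightarrow> (nat \<times> sign) list" where
  "reduce_signs [] = []"
| "reduce_signs (x # xs) =
     (case reduce_signs xs of
        [] \<Rightarrow> [x]
      | y # ys \<Rightarrow> if snd x = Minus \<and> snd y = Plus then ys else x # y # ys)"

lemma sign_normal_Nil: "sign_normal []"
  by (simp add: sign_normal_def)

lemma sign_normal_Cons:
  "sign_normal (x # xs) \<longleftrightarrow>
     sign_normal xs \<and> (snd x = Minus \<longrightarrow> (case xs of [] \<Rightarrow> True | y # ys \<Rightarrow> snd y = Minus))"
proof (cases "snd x")
  case Plus
  have "map snd (x # xs) = replicate k Plus @ replicate l Minus \<longleftrightarrow>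
      (\<exists>k'. k = Suc k' \<and> map snd xs = replicate k' Plus @ replicate l Minus)" for k l
    using Plus by (cases k; cases l) auto
  with Plus show ?thesis unfolding sign_normal_def by auto
next
  case Minus
  have "map snd (x # xs) = replicate k Plus @ replicate l Minus \<longleftrightarrow>
      k = 0 \<and> (\<exists>l'. l = Suc l' \<and> map snd xs = replicate l' Minus)" for k l
    using Minus by (cases k; cases l) auto
  then have "sign_normal (x # xs) \<longleftrightarrow> (\<exists>l. map snd xs = replicate l Minus)"
    unfolding sign_normal_def by auto
  also have "\<dots> \<longleftrightarrow>
      sign_normal xs \<and> (case xs of [] \<Rightarrow> True | y # ys \<Rightarrow> snd y = Minus)"
  proof (cases xs)
    case (Cons y ys)
    have "map snd xs = replicate k Plus @ replicate l Minus \<and> snd y = Minus \<longleftrightarrow>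
        k = 0 \<and> map snd xs = replicate l Minus" for k l
      using Cons by (cases k; cases l) auto
    then show ?thesis unfolding sign_normal_def using Cons
      by auto
  qed (simp add: sign_normal_Nil)
  finally show ?thesis using Minus by simp
qed

lemma sign_normal_reduce_signs: "sign_normal (reduce_signs ts)"
proof (induction ts)
  case (Cons x xs)
  then show ?case
    by (cases "reduce_signs xs"; cases "snd x"; cases "snd (hd (reduce_signs xs))")
       (simp_all add: sign_normal_Nil sign_normal_Cons)
qed (simp add: sign_normal_Nil)

lemma reduce_signs_normal: "sign_normal ts \<Longrightarrow> reduce_signs ts = ts"
proof (induction ts)
  case (Cons x xs)
  then show ?case
    by (cases xs) (auto simp: sign_normal_Cons)
qed simp

lemma cancels_Cons: "cancels xs ys \<Longrightarrow> cancels (x # xs) (x # ys)"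
proof (elim cancels.cases)
  fix us p q vs
  assume "xs = us @ (p, Minus) # (q, Plus) # vs" "ys = us @ vs"
  then show ?thesis using cancels.intros[of "x # us" p q vs] by simp
qed

lemma cancels_rtranclp_Cons: "cancels\<^sup>*\<^sup>* xs ys \<Longrightarrow> cancels\<^sup>*\<^sup>* (x # xs) (x # ys)"
  by (induction rule: rtranclp_induct) (auto intro: cancels_Cons rtranclp.rtrancl_into_rtrancl)

lemma cancels_reduce_signs: "cancels\<^sup>*\<^sup>* ts (reduce_signs ts)"
proof (induction ts)
  case (Cons x xs)
  have step: "cancels\<^sup>*\<^sup>* (x # xs) (x # reduce_signs xs)"
    using Cons by (rule cancels_rtranclp_Cons)
  have "cancels (x # y # ys) ys" if "snd x = Minus" "snd y = Plus" for y ys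
    using cancels.intros[of "[]" "fst x" "fst y" ys] that by (cases x; cases y) simp
  with step show ?case
    by (auto split: list.splits intro: rtranclp.rtrancl_into_rtrancl)
qed simp

lemma reduce_signs_append_cong:
  "reduce_signs ys = reduce_signs zs \<Longrightarrow> reduce_signs (xs @ ys) = reduce_signs (xs @ zs)"
  by (induction xs) auto

lemma reduce_signs_cancels: "cancels xs ys \<Longrightarrow> reduce_signs xs = reduce_signs ys"
proof (induction rule: cancels.induct)
  case (1 xs p q ys)
  show ?case
    by (rule reduce_signs_append_cong) (auto split: list.splits)
qed

lemma reduced_signature_unique:
  "cancels\<^sup>*\<^sup>* ts us \<and> sign_normal us \<longleftrightarrow> us = reduce_signs ts"
proof
  assume *: "cancels\<^sup>*\<^sup>* ts us \<and> sign_normal us"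
  then have "cancels\<^sup>*\<^sup>* ts us" ..
  then have "reduce_signs ts = reduce_signs us"
    by induction (auto dest: reduce_signs_cancels)
  with * show "us = reduce_signs ts" by (simp add: reduce_signs_normal)
qed (simp add: cancels_reduce_signs sign_normal_reduce_signs)

lemma reduced_signature_eq: "reduced_signature i \<gamma> = reduce_signs (signature i \<gamma>)"
  by (simp add: reduced_signature_def reduced_signature_unique)

end

theory Submission
  imports Defs
begin

text \<open>Reducing a signature amounts to computing in the bicyclic monoid: a list of signs is
  determined up to cancellation by the numbers of its unmatched pluses and minuses, and these
  compose by truncated subtraction. The operators therefore have a description free of indices:
  f acts on the column c of \<open>G1 @ c # G2\<close> iff c is tagged plus, \<open>G1\<close> (to the right of c)
  has no unmatched plus and \<open>G2\<close> (to the left of c) has no unmatched minus; e acts under the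
  same conditions on a column tagged minus. Hence e and f are mutually inverse, and the lengths of
  their strings are the numbers of unmatched minuses and pluses. Replacing a column by its word
  keeps both numbers, since consecutive letters i, i + 1 of a word are drawn as a cancelling
  pair, so the description carries over to the word.\<close>

section \<open>Unmatched signs\<close>

text \<open>A minus at the head can only cancel an unmatched plus of the tail, so it lowers the
  count by one; truncated subtraction keeps 0 when there is none.\<close>

fun unmatched_plus :: "('a \<times> sign) list \<Rightarrow> nat" where
  "unmatched_plus [] = 0"
| "unmatched_plus (x # xs) =
     (if snd x = Plus then Suc (unmatched_plus xs) else unmatched_plus xs - 1)"

fun unmatched_minus :: "('a \<times> sign) list \<Rightarrow> nat" where
  "unmatched_minus [] = 0"
| "unmatched_minus (x # xs) =
     (if snd x = Minus \<and> unmatched_plus xs = 0 then Suc (unmatched_minus xs)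
      else unmatched_minus xs)"

text \<open>Both lists reduce to pluses followed by minuses, so on joining them only the minuses of
  \<open>xs\<close> meet the pluses of \<open>ys\<close>, and these cancel in pairs.\<close>

lemma unmatched_plus_append:
  "unmatched_plus (xs @ ys) = unmatched_plus xs + (unmatched_plus ys - unmatched_minus xs)"
  by (induction xs) (auto intro: sign.exhaust)

lemma unmatched_minus_append:
  "unmatched_minus (xs @ ys) = unmatched_minus ys + (unmatched_minus xs - unmatched_plus ys)"
  by (induction xs) (auto simp: unmatched_plus_append)

lemma unmatched_plus_map_apfst [simp]:
  "unmatched_plus (map (apfst h) ts) = unmatched_plus ts"
  by (induction ts) auto

lemma unmatched_minus_map_apfst [simp]:
  "unmatched_minus (map (apfst h) ts) = unmatched_minus ts"
  by (induction ts) auto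

text \<open>At a head minus, \<open>reduce_signs\<close> asks whether the reduced tail starts with a
  plus. By induction this means that \<open>unmatched_plus xs\<close> is nonzero, hence the case
  split.\<close>

lemma map_snd_reduce_signs:
  "map snd (reduce_signs ts) =
     replicate (unmatched_plus ts) Plus @ replicate (unmatched_minus ts) Minus"
proof (induction ts)
  case (Cons x xs)
  show ?case
  proof (cases "unmatched_plus xs")
    case 0
    with Cons show ?thesis
      by (cases "snd x"; cases "unmatched_minus xs") (auto split: list.splits)
  next
    case (Suc k)
    with Cons show ?thesis
      by (cases "snd x") (auto split: list.splits)
  qed
qed simp

text \<open>Here \<open>xs\<close> reduces to pluses and \<open>ys\<close> to minuses, so no reduced
  sign beside \<open>z\<close> can cancel with it, whichever sign \<open>z\<close> carries. The
  index stored in \<open>z\<close> is kept, which a statement about counts would lose.\<close>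

lemma reduce_signs_unmatched:
  assumes "unmatched_minus xs = 0" "unmatched_plus ys = 0"
  shows "reduce_signs (xs @ z # ys) = reduce_signs xs @ z # reduce_signs ys"
  using assms(1)
proof (induction xs)
  case Nil
  show ?case
    using map_snd_reduce_signs[of ys] assms(2)
    by (cases "reduce_signs ys"; cases "unmatched_minus ys") auto
next
  case (Cons x xs)
  have "unmatched_minus xs = 0"
    using Cons.prems by (auto split: if_splits)
  \<comment> \<open>A head minus needs an unmatched plus in \<open>xs\<close>, since otherwise it
    would stay unmatched; so it cancels within \<open>x # xs\<close> and leaves \<open>z\<close>
    alone.\<close>
  with Cons.IH Cons.prems show ?case
    using map_snd_reduce_signs[of xs]
    by (cases "snd x"; cases "reduce_signs xs"; cases "unmatched_plus xs") auto
qed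

lemma filter_reduce_signs_eq_Nil:
  "filter (\<lambda>t. snd t = Plus) (reduce_signs ts) = [] \<longleftrightarrow> unmatched_plus ts = 0"
  "filter (\<lambda>t. snd t = Minus) (reduce_signs ts) = [] \<longleftrightarrow> unmatched_minus ts = 0"
proof -
  have "filter (\<lambda>t. snd t = s) (reduce_signs ts) = [] \<longleftrightarrow> s \<notin> set (map snd (reduce_signs ts))"
    for s
    by (auto simp: filter_empty_conv)
  then show
    "filter (\<lambda>t. snd t = Plus) (reduce_signs ts) = [] \<longleftrightarrow> unmatched_plus ts = 0"
    "filter (\<lambda>t. snd t = Minus) (reduce_signs ts) = [] \<longleftrightarrow> unmatched_minus ts = 0"
    by (auto simp: map_snd_reduce_signs)
qed

section \<open>The root operators without indices\<close>

definition gallery_phi :: "nat \<Rightarrow> gallery \<Rightarrow> nat" where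
  "gallery_phi i \<gamma> = unmatched_plus (signature i \<gamma>)"

definition gallery_eps :: "nat \<Rightarrow> gallery \<Rightarrow> nat" where
  "gallery_eps i \<gamma> = unmatched_minus (signature i \<gamma>)"

text \<open>Signatures run through decreasing indices, so the columns of \<open>H\<close>, drawn to
  the left of \<open>G\<close>, come first, with indices shifted past \<open>G\<close>.\<close>

lemma signature_append:
  "signature i (G @ H) = map (apfst ((+) (length G))) (signature i H) @ signature i G"
proof -
  have "[0..<length (G @ H)] = [0..<length G] @ map ((+) (length G)) [0..<length H]"
    by (rule nth_equalityI) (auto simp: nth_append)
  then have "rev [0..<length (G @ H)] =
      map ((+) (length G)) (rev [0..<length H]) @ rev [0..<length G]"
    by (simp add: rev_map)
  then show ?thesis
    unfolding signature_def
    by (auto simp: map_concat o_def intro!: arg_cong2[of _ _ _ _ append] arg_cong[of _ _ concat])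
       (auto simp: nth_append)
qed

lemma signature_Nil [simp]: "signature i [] = []"
  by (simp add: signature_def)

lemma signature_singleton [simp]:
  "signature i [c] = (case tag i c of None \<Rightarrow> [] | Some t \<Rightarrow> [(0, t)])"
  by (auto simp: signature_def)

text \<open>The order is reversed in the drawing: minuses of \<open>H\<close> cancel pluses of
  \<open>G\<close>.\<close>

lemma gallery_phi_append:
  "gallery_phi i (G @ H) = gallery_phi i H + (gallery_phi i G - gallery_eps i H)"
  by (simp add: gallery_phi_def gallery_eps_def signature_append unmatched_plus_append)

lemma gallery_eps_append:
  "gallery_eps i (G @ H) = gallery_eps i G + (gallery_eps i H - gallery_phi i G)"
  by (simp add: gallery_phi_def gallery_eps_def signature_append unmatched_minus_append)

lemma gallery_phi_Nil [simp]: "gallery_phi i [] = 0"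
  by (simp add: gallery_phi_def)

lemma gallery_eps_Nil [simp]: "gallery_eps i [] = 0"
  by (simp add: gallery_eps_def)

lemma gallery_phi_Cons:
  "gallery_phi i (c # G) =
     gallery_phi i G + ((if tag i c = Some Plus then 1 else 0) - gallery_eps i G)"
proof -
  have "gallery_phi i [c] = (if tag i c = Some Plus then 1 else 0)"
    by (auto simp: gallery_phi_def split: option.splits)
  then show ?thesis
    using gallery_phi_append[of i "[c]" G] by simp
qed

lemma gallery_eps_Cons:
  "gallery_eps i (c # G) =
     (if tag i c = Some Minus then 1 else 0) +
     (gallery_eps i G - (if tag i c = Some Plus then 1 else 0))"
proof -
  have "gallery_phi i [c] = (if tag i c = Some Plus then 1 else 0)"
    by (auto simp: gallery_phi_def split: option.splits)
  moreover have "gallery_eps i [c] = (if tag i c = Some Minus then 1 else 0)"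
    by (auto simp: gallery_eps_def intro: sign.exhaust split: option.splits)
  ultimately show ?thesis
    using gallery_eps_append[of i "[c]" G] by simp
qed

lemmas gallery_phi_eps_simps =
  gallery_phi_append gallery_eps_append gallery_phi_Cons gallery_eps_Cons

text \<open>The induction adds columns at the right. The new column is the one sought if it is a
  plus that no unmatched minus to its left absorbs; otherwise the column found earlier still
  serves.\<close>

lemma plus_column_exists:
  assumes "gallery_phi i \<gamma> \<noteq> 0"
  obtains G c H where "\<gamma> = G @ c # H" "tag i c = Some Plus"
    "gallery_phi i G = 0" "gallery_eps i H = 0"
  using assms
proof (induction \<gamma> arbitrary: thesis)
  case (Cons a \<gamma>)
  show ?case
  proof (cases "tag i a = Some Plus \<and> gallery_eps i \<gamma> = 0")
    case True
    then show ?thesis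
      using Cons.prems(1)[of "[]" a \<gamma>] by simp
  next
    case False
    then have "gallery_phi i \<gamma> \<noteq> 0"
      using Cons.prems(2) by (auto simp: gallery_phi_Cons split: if_splits)
    then obtain G c H where *: "\<gamma> = G @ c # H" "tag i c = Some Plus"
      "gallery_phi i G = 0" "gallery_eps i H = 0"
      using Cons.IH by blast
    \<comment> \<open>If \<open>a\<close> is a plus, \<open>\<gamma>\<close> has an unmatched minus.
      As \<open>c # H\<close> has none, it lies in \<open>G\<close> and absorbs the plus of
      \<open>a\<close>.\<close>
    then have "gallery_phi i (a # G) = 0"
      using False by (auto simp: gallery_phi_eps_simps)
    with * show ?thesis
      using Cons.prems(1)[of "a # G" c H] by simp
  qed
qed simp

lemma minus_column_exists:
  assumes "gallery_eps i \<gamma> \<noteq> 0"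
  obtains G c H where "\<gamma> = G @ c # H" "tag i c = Some Minus"
    "gallery_phi i G = 0" "gallery_eps i H = 0"
  using assms
proof (induction \<gamma> arbitrary: thesis)
  case (Cons a \<gamma>)
  show ?case
  proof (cases "tag i a = Some Minus \<and> gallery_eps i \<gamma> = 0")
    case True
    then show ?thesis
      using Cons.prems(1)[of "[]" a \<gamma>] by simp
  next
    case False
    then have "gallery_eps i \<gamma> \<noteq> 0"
      using Cons.prems(2) by (auto simp: gallery_eps_Cons split: if_splits)
    then obtain G c H where *: "\<gamma> = G @ c # H" "tag i c = Some Minus"
      "gallery_phi i G = 0" "gallery_eps i H = 0"
      using Cons.IH by blast
    \<comment> \<open>If \<open>a\<close> is a plus, an unmatched minus survives its cancellation
      only if \<open>\<gamma>\<close> has at least two. The part \<open>c # H\<close> supplies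
      exactly one, so \<open>G\<close> has one to absorb \<open>a\<close>.\<close>
    then have "gallery_phi i (a # G) = 0"
      using False Cons.prems(2) by (auto simp: gallery_phi_eps_simps split: if_splits)
    with * show ?thesis
      using Cons.prems(1)[of "a # G" c H] by simp
  qed
qed simp

text \<open>This serves both operators: for a plus, \<open>c\<close> is the last plus because
  \<open>vs\<close> has none; for a minus, \<open>c\<close> is the first minus because
  \<open>us\<close> has none.\<close>

lemma reduced_signature_split:
  assumes "tag i c = Some t" "gallery_phi i G = 0" "gallery_eps i H = 0"
  obtains us vs where "reduced_signature i (G @ c # H) = us @ (length G, t) # vs"
    "filter (\<lambda>t. snd t = Minus) us = []" "filter (\<lambda>t. snd t = Plus) vs = []"
proof -
  let ?H = "map (apfst ((+) (Suc (length G)))) (signature i H)"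
  have "signature i (G @ c # H) = ?H @ (length G, t) # signature i G"
    using assms(1) signature_append[of i "G @ [c]" H] signature_append[of i G "[c]"] by simp
  moreover have "unmatched_minus ?H = 0" "unmatched_plus (signature i G) = 0"
    using assms by (simp_all add: gallery_phi_def gallery_eps_def)
  ultimately show thesis
    using that[of "reduce_signs ?H" "reduce_signs (signature i G)"]
    by (simp add: reduced_signature_eq reduce_signs_unmatched filter_reduce_signs_eq_Nil)
qed

lemma sign_positions:
  "[s. (s, t) \<leftarrow> ts, t = a] = map fst (filter (\<lambda>t. snd t = a) ts)"
  by (induction ts) auto

lemma gallery_f_eq_None_iff: "gallery_f i \<gamma> = None \<longleftrightarrow> gallery_phi i \<gamma> = 0"
  using filter_reduce_signs_eq_Nil(1)[of "signature i \<gamma>"]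
  by (simp add: gallery_f_def sign_positions reduced_signature_eq gallery_phi_def Let_def)

lemma gallery_e_eq_None_iff: "gallery_e i \<gamma> = None \<longleftrightarrow> gallery_eps i \<gamma> = 0"
  using filter_reduce_signs_eq_Nil(2)[of "signature i \<gamma>"]
  by (simp add: gallery_e_def sign_positions reduced_signature_eq gallery_eps_def Let_def)

lemma gallery_f_split:
  assumes "tag i c = Some Plus" "gallery_phi i G = 0" "gallery_eps i H = 0"
  shows "gallery_f i (G @ c # H) = Some (G @ replace_entry i (i + 1) c # H)"
proof -
  obtain us vs where "reduced_signature i (G @ c # H) = us @ (length G, Plus) # vs"
    "filter (\<lambda>t. snd t = Plus) vs = []"
    using reduced_signature_split[OF assms] by blast
  then show ?thesis
    by (simp add: gallery_f_def sign_positions)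
qed

lemma gallery_e_split:
  assumes "tag i c = Some Minus" "gallery_phi i G = 0" "gallery_eps i H = 0"
  shows "gallery_e i (G @ c # H) = Some (G @ replace_entry (i + 1) i c # H)"
proof -
  obtain us vs where "reduced_signature i (G @ c # H) = us @ (length G, Minus) # vs"
    "filter (\<lambda>t. snd t = Minus) us = []"
    using reduced_signature_split[OF assms] by blast
  then show ?thesis
    by (simp add: gallery_e_def sign_positions)
qed

lemma gallery_f_SomeE:
  assumes "gallery_f i \<gamma> = Some \<gamma>'"
  obtains G c H where "\<gamma> = G @ c # H" "\<gamma>' = G @ replace_entry i (i + 1) c # H"
    "tag i c = Some Plus" "gallery_phi i G = 0" "gallery_eps i H = 0"
proof -
  have "gallery_phi i \<gamma> \<noteq> 0"
    using assms gallery_f_eq_None_iff[of i \<gamma>] by simp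
  then obtain G c H where *: "\<gamma> = G @ c # H" "tag i c = Some Plus"
    "gallery_phi i G = 0" "gallery_eps i H = 0"
    by (rule plus_column_exists)
  with gallery_f_split[OF *(2-4)] assms that show thesis
    by simp
qed

lemma gallery_e_SomeE:
  assumes "gallery_e i \<gamma> = Some \<gamma>'"
  obtains G c H where "\<gamma> = G @ c # H" "\<gamma>' = G @ replace_entry (i + 1) i c # H"
    "tag i c = Some Minus" "gallery_phi i G = 0" "gallery_eps i H = 0"
proof -
  have "gallery_eps i \<gamma> \<noteq> 0"
    using assms gallery_e_eq_None_iff[of i \<gamma>] by simp
  then obtain G c H where *: "\<gamma> = G @ c # H" "tag i c = Some Minus"
    "gallery_phi i G = 0" "gallery_eps i H = 0"
    by (rule minus_column_exists)
  with gallery_e_split[OF *(2-4)] assms that show thesis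
    by simp
qed

section \<open>Tags and entries under replacement of a letter\<close>

lemma tag_eq_Some_iff:
  "tag i c = Some Plus \<longleftrightarrow> i \<in> set c \<and> i + 1 \<notin> set c"
  "tag i c = Some Minus \<longleftrightarrow> i + 1 \<in> set c \<and> i \<notin> set c"
  by (auto simp: tag_def)

lemma set_replace_entry:
  "set (replace_entry a b c) = (if a \<in> set c then insert b (set c - {a}) else set c)"
  by (auto simp: replace_entry_def)

lemma length_replace_entry: "length (replace_entry a b c) = length c"
  by (simp add: replace_entry_def)

lemma replace_entry_id: "a \<notin> set c \<Longrightarrow> replace_entry a b c = c"
  by (auto simp: replace_entry_def intro: map_idI)

lemma replace_entry_inverse: "b \<notin> set c \<Longrightarrow> replace_entry b a (replace_entry a b c) = c"
  by (auto simp: replace_entry_def o_def intro: map_idI)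

lemma tag_replace_entry:
  "tag i c = Some Plus \<Longrightarrow> tag i (replace_entry i (i + 1) c) = Some Minus"
  "tag i c = Some Minus \<Longrightarrow> tag i (replace_entry (i + 1) i c) = Some Plus"
  by (auto simp: tag_eq_Some_iff set_replace_entry)

text \<open>Replacement flips the sign of \<open>c\<close> and leaves \<open>G\<close> and
  \<open>H\<close> alone, and the conditions on \<open>G\<close> and \<open>H\<close> are the same
  for both operators.\<close>

lemma gallery_e_iff_gallery_f: "gallery_e i \<gamma> = Some \<gamma>' \<longleftrightarrow> gallery_f i \<gamma>' = Some \<gamma>"
proof
  assume "gallery_e i \<gamma> = Some \<gamma>'"
  then obtain G c H where *: "\<gamma> = G @ c # H" "\<gamma>' = G @ replace_entry (i + 1) i c # H"
    "tag i c = Some Minus" "gallery_phi i G = 0" "gallery_eps i H = 0"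
    by (rule gallery_e_SomeE)
  with gallery_f_split[OF tag_replace_entry(2)[OF *(3)] *(4,5)] show "gallery_f i \<gamma>' = Some \<gamma>"
    by (simp add: replace_entry_inverse tag_eq_Some_iff)
next
  assume "gallery_f i \<gamma>' = Some \<gamma>"
  then obtain G c H where *: "\<gamma>' = G @ c # H" "\<gamma> = G @ replace_entry i (i + 1) c # H"
    "tag i c = Some Plus" "gallery_phi i G = 0" "gallery_eps i H = 0"
    by (rule gallery_f_SomeE)
  with gallery_e_split[OF tag_replace_entry(1)[OF *(3)] *(4,5)] show "gallery_e i \<gamma> = Some \<gamma>'"
    by (simp add: replace_entry_inverse tag_eq_Some_iff)
qed

section \<open>String lengths\<close>

text \<open>The column \<open>c\<close> carries a single unmatched sign, which changes from plus to
  minus; no other matching is affected.\<close>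

lemma gallery_phi_eps_f:
  assumes "gallery_f i \<gamma> = Some \<gamma>'"
  shows "gallery_phi i \<gamma> = Suc (gallery_phi i \<gamma>')" "gallery_eps i \<gamma>' = Suc (gallery_eps i \<gamma>)"
proof -
  obtain G c H where "\<gamma> = G @ c # H" "\<gamma>' = G @ replace_entry i (i + 1) c # H"
    "tag i c = Some Plus" "gallery_phi i G = 0" "gallery_eps i H = 0"
    using assms by (rule gallery_f_SomeE)
  then show "gallery_phi i \<gamma> = Suc (gallery_phi i \<gamma>')" "gallery_eps i \<gamma>' = Suc (gallery_eps i \<gamma>)"
    using tag_replace_entry(1)[of i c] by (simp_all add: gallery_phi_eps_simps)
qed

lemma iterate_op_0: "iterate_op g 0 b = Some b"
  by (simp add: iterate_op_def)

text \<open>The definition unfolds at the last application; the induction on strings needs the first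
  one split off.\<close>

lemma iterate_op_Suc: "iterate_op g (Suc m) b = Option.bind (g b) (iterate_op g m)"
proof -
  have "((\<lambda>x. Option.bind x g) ^^ m) None = None"
    by (induction m) auto
  then show ?thesis
    by (cases "g b") (simp_all add: iterate_op_def funpow_Suc_right del: funpow.simps)
qed

text \<open>\<open>N\<close> counts the remaining steps: it drops by one at each application and
  vanishes exactly where \<open>g\<close> is undefined.\<close>

lemma iterate_op_defined_iff:
  assumes "\<And>b. g b = None \<longleftrightarrow> N b = 0" "\<And>b b'. g b = Some b' \<Longrightarrow> N b = Suc (N b')"
  shows "iterate_op g m b \<noteq> None \<longleftrightarrow> m \<le> N b"
proof (induction m arbitrary: b)
  case 0
  show ?case by (simp add: iterate_op_0)
next
  case (Suc m)
  show ?case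
  proof (cases "g b")
    case None
    with assms(1)[of b] show ?thesis by (simp add: iterate_op_Suc)
  next
    case (Some b')
    with assms(2)[of b b'] Suc[of b'] show ?thesis by (simp add: iterate_op_Suc)
  qed
qed

lemma iterate_gallery_f: "{m. iterate_op (gallery_f i) m \<gamma> \<noteq> None} = {..gallery_phi i \<gamma>}"
  using iterate_op_defined_iff[of "gallery_f i" "gallery_phi i"]
  by (auto simp: gallery_f_eq_None_iff dest: gallery_phi_eps_f)

lemma iterate_gallery_e: "{m. iterate_op (gallery_e i) m \<gamma> \<noteq> None} = {..gallery_eps i \<gamma>}"
  using iterate_op_defined_iff[of "gallery_e i" "gallery_eps i"]
  by (auto simp: gallery_e_eq_None_iff gallery_e_iff_gallery_f dest: gallery_phi_eps_f)

section \<open>The difference of the string lengths as a difference of letter counts\<close>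

lemma count_list_distinct: "distinct c \<Longrightarrow> count_list c a = (if a \<in> set c then 1 else 0)"
  by (induction c) auto

lemma Max_atMost: "Max {..k} = (k :: nat)"
  by (rule Max_eqI) auto

lemma sorted_wrt_less_distinct: "sorted_wrt (<) c \<Longrightarrow> distinct (c :: nat list)"
  by (simp add: strict_sorted_iff)

text \<open>Each cancellation removes one plus and one minus, so the difference is additive over
  columns. A column containing both letters contributes 0 to either side.\<close>

lemma gallery_phi_minus_eps:
  assumes "\<forall>c\<in>set \<gamma>. distinct c"
  shows "int (gallery_phi i \<gamma>) - int (gallery_eps i \<gamma>) =
    int (count_list (concat \<gamma>) i) - int (count_list (concat \<gamma>) (i + 1))"
  using assms
proof (induction \<gamma>)
  case (Cons c \<gamma>)
  have count: "count_list c j = (if j \<in> set c then 1 else 0)" for j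
    using Cons.prems by (simp add: count_list_distinct)
  have "int (gallery_phi i (c # \<gamma>)) - int (gallery_eps i (c # \<gamma>)) =
      int (gallery_phi i \<gamma>) - int (gallery_eps i \<gamma>)
      + int (count_list c i) - int (count_list c (i + 1))"
    unfolding count gallery_phi_Cons gallery_eps_Cons tag_eq_Some_iff by auto
  with Cons show ?case by (simp add: count_list_append)
qed simp

section \<open>Weights\<close>

text \<open>A representative of the weight that depends on the columns only through their
  concatenation, hence only on the word.\<close>

definition content :: "nat \<Rightarrow> gallery \<Rightarrow> nat \<Rightarrow>\<^sub>0 int" where
  "content n \<gamma> = (\<Sum>j\<in>{1..n}. Poly_Mapping.single j (int (count_list (concat \<gamma>) j)))"

lemma gallery_wt_eq: "gallery_wt n \<gamma> = weight_class n (content n \<gamma>)"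
proof -
  have "(\<Sum>c\<leftarrow>\<gamma>. int (count_list c j)) = int (count_list (concat \<gamma>) j)" for j
    by (induction \<gamma>) (auto simp: count_list_append)
  then show ?thesis by (simp add: gallery_wt_def content_def)
qed

lemma lookup_content:
  "Poly_Mapping.lookup (content n \<gamma>) j =
     (if j \<in> {1..n} then int (count_list (concat \<gamma>) j) else 0)"
  by (auto simp: content_def lookup_sum lookup_single when_def)

lemma content_in_carrier: "content n \<gamma> \<in> carrier (free_Abelian_group {1..n})"
  by (auto simp: free_Abelian_group_def in_keys_iff lookup_content split: if_splits)

lemma simple_root_vector_in_carrier:
  fixes i n :: nat
  shows "i \<in> {1..<n} \<Longrightarrow>
     frag_of i - frag_of (i + 1) \<in> carrier (free_Abelian_group {1..n})"
  by (auto simp: free_Abelian_group_def in_keys_iff lookup_minus lookup_single when_def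
      split: if_splits)

lemma normal_eps_relation: "eps_relation n \<lhd> free_Abelian_group {1..n}"
proof -
  have "(\<Sum>i\<in>{1..n}. frag_of i) \<in> carrier (free_Abelian_group {1..n})"
    by (auto simp: free_Abelian_group_def intro!: Poly_Mapping.keys_sum[THEN subset_trans])
  then have "subgroup (eps_relation n) (free_Abelian_group {1..n})"
    unfolding eps_relation_def by (intro group.generate_is_subgroup) auto
  then show ?thesis
    by (rule comm_group.subgroup_imp_normal[OF abelian_free_Abelian_group])
qed

lemma weight_class_in_carrier:
  "v \<in> carrier (free_Abelian_group {1..n}) \<Longrightarrow> weight_class n v \<in> carrier (weight_lattice n)"
  unfolding weight_lattice_def FactGroup_def weight_class_def RCOSETS_def by auto

lemma weight_class_add:
  assumes "v \<in> carrier (free_Abelian_group {1..n})" "w \<in> carrier (free_Abelian_group {1..n})"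
  shows "weight_class n (v + w) = weight_class n v \<otimes>\<^bsub>weight_lattice n\<^esub> weight_class n w"
  using normal.rcos_sum[OF normal_eps_relation assms]
  by (simp add: weight_lattice_def FactGroup_def weight_class_def)

lemma count_list_replace_entry:
  assumes "distinct c" "a \<in> set c" "b \<notin> set c"
  shows "int (count_list (replace_entry a b c) j) =
    int (count_list c j) + (if j = b then 1 else 0) - (if j = a then 1 else 0)"
proof -
  have "distinct (replace_entry a b c)"
    using assms by (auto simp: replace_entry_def distinct_map inj_on_def)
  with assms show ?thesis
    by (auto simp: count_list_distinct set_replace_entry)
qed

lemma gallery_wt_e:
  assumes i: "i \<in> {1..<n}" and "\<forall>c\<in>set \<gamma>. distinct c" and "gallery_e i \<gamma> = Some \<gamma>'"
  shows "gallery_wt n \<gamma>' = gallery_wt n \<gamma> \<otimes>\<^bsub>weight_lattice n\<^esub> simple_root n i"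
proof -
  obtain G c H where *: "\<gamma> = G @ c # H" "\<gamma>' = G @ replace_entry (i + 1) i c # H"
    "tag i c = Some Minus"
    using assms(3) by (rule gallery_e_SomeE)
  have "int (count_list (replace_entry (i + 1) i c) j) =
      int (count_list c j) + (if j = i then 1 else 0) - (if j = i + 1 then 1 else 0)" for j
    using * assms(2) by (intro count_list_replace_entry) (auto simp: tag_eq_Some_iff)
  \<comment> \<open>The identity holds already for representatives; both \<open>i\<close> and
    \<open>i + 1\<close> lie in the range kept by \<open>content\<close>.\<close>
  then have "content n \<gamma>' = content n \<gamma> + (frag_of i - frag_of (i + 1))"
    using i by (intro poly_mapping_eqI)
      (auto simp: * lookup_content count_list_append lookup_add lookup_minus lookup_single
        when_def)
  then show ?thesis
    using weight_class_add[OF content_in_carrier simple_root_vector_in_carrier[OF i]]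
    by (simp only: gallery_wt_eq simple_root_def)
qed

section \<open>Galleries form a crystal\<close>

text \<open>No integer lies strictly between \<open>i\<close> and \<open>i + 1\<close>, so only an
  entry already equal to the new value could break the strict order.\<close>

lemma sorted_wrt_replace_entry:
  assumes "sorted_wrt (<) c"
  shows "i + 1 \<notin> set c \<Longrightarrow> sorted_wrt (<) (replace_entry i (i + 1) c)"
    and "i \<notin> set c \<Longrightarrow> sorted_wrt (<) (replace_entry (i + 1) i c)"
proof -
  show "sorted_wrt (<) (replace_entry i (i + 1) c)" if "i + 1 \<notin> set c"
    unfolding replace_entry_def sorted_wrt_map
  proof (rule sorted_wrt_mono_rel[OF _ assms])
    fix x y
    assume "x \<in> set c" "y \<in> set c" "x < y"
    with that have "y \<noteq> i + 1" by blast
    with \<open>x < y\<close> show "(if x = i then i + 1 else x) < (if y = i then i + 1 else y)"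
      by simp
  qed
  show "sorted_wrt (<) (replace_entry (i + 1) i c)" if "i \<notin> set c"
    unfolding replace_entry_def sorted_wrt_map
  proof (rule sorted_wrt_mono_rel[OF _ assms])
    fix x y
    assume "x \<in> set c" "y \<in> set c" "x < y"
    with that have "x \<noteq> i" by blast
    with \<open>x < y\<close> show "(if x = i + 1 then i else x) < (if y = i + 1 then i else y)"
      by simp
  qed
qed

lemma galleries_replace_column:
  assumes "G @ c # H \<in> galleries n d" "length c' = length c"
    "sorted_wrt (<) c'" "set c' \<subseteq> {1..n}"
  shows "G @ c' # H \<in> galleries n d"
  using assms by (auto simp: galleries_def)

lemma gallery_f_closed:
  assumes i: "i \<in> {1..<n}" and \<gamma>: "\<gamma> \<in> galleries n d" and "gallery_f i \<gamma> = Some \<gamma>'"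
  shows "\<gamma>' \<in> galleries n d"
proof -
  obtain G c H where *: "\<gamma> = G @ c # H" "\<gamma>' = G @ replace_entry i (i + 1) c # H"
    "tag i c = Some Plus"
    using assms(3) by (rule gallery_f_SomeE)
  then have "sorted_wrt (<) c" "set c \<subseteq> {1..n}"
    using \<gamma> by (auto simp: galleries_def)
  then show ?thesis
    using * i \<gamma> galleries_replace_column[of G c H n d "replace_entry i (i + 1) c"]
    by (auto simp: tag_eq_Some_iff sorted_wrt_replace_entry[simplified] set_replace_entry
        length_replace_entry subset_iff)
qed

lemma gallery_e_closed:
  assumes i: "i \<in> {1..<n}" and \<gamma>: "\<gamma> \<in> galleries n d" and "gallery_e i \<gamma> = Some \<gamma>'"
  shows "\<gamma>' \<in> galleries n d"
proof -
  obtain G c H where *: "\<gamma> = G @ c # H" "\<gamma>' = G @ replace_entry (i + 1) i c # H"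
    "tag i c = Some Minus"
    using assms(3) by (rule gallery_e_SomeE)
  then have "sorted_wrt (<) c" "set c \<subseteq> {1..n}"
    using \<gamma> by (auto simp: galleries_def)
  then show ?thesis
    using * i \<gamma> galleries_replace_column[of G c H n d "replace_entry (i + 1) i c"]
    by (auto simp: tag_eq_Some_iff sorted_wrt_replace_entry[simplified] set_replace_entry
        length_replace_entry subset_iff)
qed

section \<open>Verification of the crystal axioms\<close>

lemma gallery_crystal_simps [simp]:
  "elems (gallery_crystal n d) = galleries n d"
  "wt (gallery_crystal n d) = gallery_wt n"
  "e_op (gallery_crystal n d) = gallery_e"
  "f_op (gallery_crystal n d) = gallery_f"
  by (simp_all add: gallery_crystal_def)

lemma phi_len_gallery_crystal: "phi_len (gallery_crystal n d) i \<gamma> = gallery_phi i \<gamma>"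
  unfolding phi_len_def gallery_crystal_simps iterate_gallery_f by (rule Max_atMost)

lemma eps_len_gallery_crystal: "eps_len (gallery_crystal n d) i \<gamma> = gallery_eps i \<gamma>"
  unfolding eps_len_def gallery_crystal_simps iterate_gallery_e by (rule Max_atMost)

lemma crystal_gallery_crystal: "crystal n (gallery_crystal n d)"
proof (rule crystal.intro, unfold gallery_crystal_simps)
  show "gallery_wt n \<gamma> \<in> carrier (weight_lattice n)" for \<gamma>
    unfolding gallery_wt_eq by (intro weight_class_in_carrier content_in_carrier)
  fix i \<gamma>
  assume i: "i \<in> {1..<n}" and \<gamma>: "\<gamma> \<in> galleries n d"
  have distinct: "\<forall>c\<in>set \<gamma>. distinct c"
    using \<gamma> by (auto simp: galleries_def sorted_wrt_less_distinct)
  show "\<gamma>' \<in> galleries n d" if "gallery_e i \<gamma> = Some \<gamma>'" for \<gamma>'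
    using i \<gamma> that by (rule gallery_e_closed)
  show "\<gamma>' \<in> galleries n d" if "gallery_f i \<gamma> = Some \<gamma>'" for \<gamma>'
    using i \<gamma> that by (rule gallery_f_closed)
  show "gallery_e i \<gamma> = Some \<gamma>' \<longleftrightarrow> gallery_f i \<gamma>' = Some \<gamma>" for \<gamma>'
    by (rule gallery_e_iff_gallery_f)
  show "gallery_wt n \<gamma>' = gallery_wt n \<gamma> \<otimes>\<^bsub>weight_lattice n\<^esub> simple_root n i"
    if "gallery_e i \<gamma> = Some \<gamma>'" for \<gamma>'
    using i distinct that by (rule gallery_wt_e)
  show "finite {m. iterate_op (gallery_e i) m \<gamma> \<noteq> None}"
    unfolding iterate_gallery_e by (rule finite_atMost)
  show "finite {m. iterate_op (gallery_f i) m \<gamma> \<noteq> None}"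
    unfolding iterate_gallery_f by (rule finite_atMost)
  have "coroot_pairing (gallery_wt n \<gamma>) i =
      int (count_list (concat \<gamma>) i) - int (count_list (concat \<gamma>) (i + 1))"
    using i coroot_pairing_weight_class[OF i, of "content n \<gamma>"]
    by (simp add: gallery_wt_eq lookup_content)
  then show "int (phi_len (gallery_crystal n d) i \<gamma>) =
      int (eps_len (gallery_crystal n d) i \<gamma>) + coroot_pairing (gallery_wt n \<gamma>) i"
    using gallery_phi_minus_eps[OF distinct, of i]
    by (simp add: phi_len_gallery_crystal eps_len_gallery_crystal)
qed

section \<open>Passing to words\<close>

lemma gallery_of_word_append:
  "gallery_of_word (v @ w) = gallery_of_word v @ gallery_of_word w"
  by (simp add: gallery_of_word_def)

lemma concat_gallery_of_word: "concat (gallery_of_word w) = w"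
  by (simp add: gallery_of_word_def)

text \<open>Only the letters \<open>i\<close> and \<open>i + 1\<close> are tagged, each occurring at
  most once. If both occur, \<open>i\<close> is read first, so the minus is drawn to the left of the
  plus and they cancel.\<close>

lemma gallery_phi_eps_of_column:
  assumes "sorted_wrt (<) c"
  shows "gallery_phi i (gallery_of_word c) = (if tag i c = Some Plus then 1 else 0)"
    and "gallery_eps i (gallery_of_word c) = (if tag i c = Some Minus then 1 else 0)"
  using assms
  by (induction c)
     (auto simp: gallery_of_word_def gallery_phi_Cons gallery_eps_Cons tag_eq_Some_iff)

lemma gallery_phi_eps_of_word:
  assumes "\<forall>c\<in>set \<gamma>. sorted_wrt (<) c"
  shows "gallery_phi i (gallery_of_word (word \<gamma>)) = gallery_phi i \<gamma>"
    and "gallery_eps i (gallery_of_word (word \<gamma>)) = gallery_eps i \<gamma>"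
  using assms
  by (induction \<gamma>)
     (auto simp: word_def gallery_of_word_append gallery_phi_append gallery_eps_append
       gallery_phi_Cons gallery_eps_Cons gallery_phi_eps_of_column gallery_of_word_def[of "[]"])

text \<open>The letter \<open>i\<close> of the column \<open>c\<close> is the one on which the
  operator acts in the word: the other letters of \<open>c\<close> are untagged, so the conditions
  on \<open>G\<close> and \<open>H\<close> pass to the words on either side.\<close>

lemma gallery_f_of_word:
  assumes "\<forall>c\<in>set \<gamma>. sorted_wrt (<) c" and f: "gallery_f i \<gamma> = Some \<gamma>'"
  shows "gallery_f i (gallery_of_word (word \<gamma>)) = Some (gallery_of_word (word \<gamma>'))"
proof -
  obtain G c H where *: "\<gamma> = G @ c # H" "\<gamma>' = G @ replace_entry i (i + 1) c # H"
    and tag: "tag i c = Some Plus" and unmatched: "gallery_phi i G = 0" "gallery_eps i H = 0"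
    using f by (rule gallery_f_SomeE)
  obtain u v where c: "c = u @ i # v"
    using tag by (auto simp: tag_eq_Some_iff dest: split_list)
  have sorted: "sorted_wrt (<) u" "sorted_wrt (<) v" "i \<notin> set u" "i \<notin> set v"
    using assms(1) unfolding * c by (auto simp: sorted_wrt_append)
  have "i + 1 \<notin> set u" "i + 1 \<notin> set v"
    using tag unfolding c by (auto simp: tag_eq_Some_iff)
  with sorted have "gallery_phi i (gallery_of_word (word G @ u)) = 0"
    "gallery_eps i (gallery_of_word (v @ word H)) = 0"
    using assms(1) unmatched unfolding *
    by (auto simp: gallery_of_word_append gallery_phi_append gallery_eps_append
        gallery_phi_eps_of_word gallery_phi_eps_of_column tag_eq_Some_iff)
  moreover have "tag i [i] = Some Plus"
    by (simp add: tag_def)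
  moreover have "replace_entry i (i + 1) c = u @ (i + 1) # v"
    using sorted(3,4) replace_entry_id[of i _ "i + 1"] by (simp add: c replace_entry_def)
  ultimately show ?thesis
    using gallery_f_split[of i "[i]" "gallery_of_word (word G @ u)" "gallery_of_word (v @ word H)"]
    by (simp add: * c word_def gallery_of_word_def replace_entry_def)
qed

theorem proposition2p7:
  fixes n :: nat and d :: "nat list"
  assumes "n \<ge> 1" and "is_shape n d"
  shows "crystal_morphism n (gallery_crystal n d)
           (gallery_crystal n (replicate (sum_list d) 1))
           (\<lambda>\<gamma>. gallery_of_word (word \<gamma>))"
proof -
  have f: "gallery_f i (gallery_of_word (word \<gamma>)) =
      map_option (\<lambda>\<gamma>. gallery_of_word (word \<gamma>)) (gallery_f i \<gamma>)"
    if "\<gamma> \<in> galleries n d" for i \<gamma>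
  proof (cases "gallery_f i \<gamma>")
    case None
    with that have "gallery_f i (gallery_of_word (word \<gamma>)) = None"
      by (simp add: gallery_f_eq_None_iff gallery_phi_eps_of_word galleries_def)
    with None show ?thesis by simp
  next
    case (Some \<gamma>')
    with that show ?thesis
      by (simp add: gallery_f_of_word galleries_def)
  qed
  have e: "gallery_e i (gallery_of_word (word \<gamma>)) =
      map_option (\<lambda>\<gamma>. gallery_of_word (word \<gamma>)) (gallery_e i \<gamma>)"
    if "i \<in> {1..<n}" "\<gamma> \<in> galleries n d" for i \<gamma>
  proof (cases "gallery_e i \<gamma>")
    case None
    with that have "gallery_e i (gallery_of_word (word \<gamma>)) = None"
      by (simp add: gallery_e_eq_None_iff gallery_phi_eps_of_word galleries_def)
    with None show ?thesis by simp
  next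
    case (Some \<gamma>')
    \<comment> \<open>The statement for e reduces to the one for f applied to
      \<open>\<gamma>'\<close>, which must first be known to be a gallery.\<close>
    then have "\<gamma>' \<in> galleries n d"
      using that gallery_e_closed by blast
    with f[of \<gamma>' i] Some
    have "gallery_e i (gallery_of_word (word \<gamma>)) = Some (gallery_of_word (word \<gamma>'))"
      by (simp add: gallery_e_iff_gallery_f)
    with Some show ?thesis by simp
  qed
  have "gallery_of_word (word \<gamma>) \<in> galleries n (replicate (sum_list d) 1)"
    if "\<gamma> \<in> galleries n d" for \<gamma>
    using that
    by (auto simp: galleries_def gallery_of_word_def word_def length_concat o_def
        map_replicate_const subset_iff)
  \<comment> \<open>Both galleries have the same concatenation and therefore the same
    \<open>content\<close>.\<close>
  moreover have "gallery_wt n (gallery_of_word (word \<gamma>)) = gallery_wt n \<gamma>" for \<gamma>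
    by (simp add: gallery_wt_eq content_def concat_gallery_of_word) (simp add: word_def)
  ultimately show ?thesis
    using e f
    by (intro crystal_morphism.intro crystal_gallery_crystal crystal_morphism_axioms.intro)
       auto
qed

end
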